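(* Let $k\ge 1$ be an integer and let $c\in(0,1)$ be a constant with $c>\frac{1}{2^k}$. Then the $c$-bisection auction for the two-bidder $2^{nd}$-price auction on $k$-bit inputs has worst-case objective privacy-approximation ratio at least $2^{k/2}$.
   Context: Communication model. Bidders $1$ and $2$ hold private inputs $x_1,x_2\in\{0,\ldots,2^k-1\}$ respectively. In a deterministic protocol $P$ the parties exchange (announce) bits; the identity of the next sender is determined by the history of bits sent so far, and each bit is a function of the sender's own input and the history. The sequence of all bits sent on input $(x_1,x_2)$ is the transcript. $P$ is a protocol for a function $f$ if the transcript determines $f(x_1,x_2)$. For an input $(x_1,x_2)$ let $R^P(x_1,x_2)$ be the set of all inputs having the same transcript as $(x_1,x_2)$; it is a combinatorial rectangle on which $f$ is constant. Let $R^I(x_1,x_2)=\{(x_1',x_2'): f(x_1',x_2')=f(x_1,x_2)\}$. The worst-case objective privacy-approximation ratio (PAR) of $P$ is $\max_{(x_1,x_2)}|R^I(x_1,x_2)|/|R^P(x_1,x_2)|$. $2^{nd}$-price auction: $f(x_1,x_2)$ is the pair consisting of the identity of the bidder with the higher value (ties broken in favor of bidder $1$) and the value of the other bidder; i.e. $f(x_1,x_2)=(1,x_2)$ if $x_1\ge x_2$ and $f(x_1,x_2)=(2,x_1)$ if $x_1<x_2$. $c$-bisection auction: start with the integer interval $R=\{0,\ldots,2^k-1\}$. At each step, the current interval $R$ (containing both values, $|R|\ge2$) is partitioned into a lower subinterval of size $c|R|$ and an upper subinterval of size $(1-c)|R|$ (sizes rounded to positive integers summing to $|R|$ by a fixed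 rule), and each of the two bidders announces which subinterval contains its value. If the answers agree, continue with the common subinterval; if this goes on until the interval has one element, the values are equal and the item goes to bidder $1$ at the common value. If the answers differ, the bidder in the upper subinterval wins, and the exact value of the other bidder is then found by continuing the same kind of interval search (with ratio $c$) on the lower subinterval, with only the losing bidder answering. *)

theory Defs
  imports Complex_Main
begin

datatype bidder = Bidder1 | Bidder2

fun own_input :: "bidder \<Rightarrow> nat \<times> nat \<Rightarrow> nat" where
  "own_input Bidder1 (x1, x2) = x1"
| "own_input Bidder2 (x1, x2) = x2"

text \<open>
  A deterministic two-party protocol as a protocol tree. The nodes of the tree are the possible
  histories, so the sender and the message function attached to a node depend on exactly the
  history. In \<open>Send b m P0 P1\<close> the sender \<open>b\<close> announces the bit \<open>m x\<close>, where \<open>x\<close> is its own input;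
  the protocol continues with \<open>P0\<close> if the bit is \<open>False\<close> and with \<open>P1\<close> if it is \<open>True\<close>.
\<close>

datatype protocol = Halt | Send bidder "nat \<Rightarrow> bool" protocol protocol

fun transcript :: "protocol \<Rightarrow> nat \<times> nat \<Rightarrow> bool list" where
  "transcript Halt x = []"
| "transcript (Send b m P0 P1) x =
     (if m (own_input b x) then True # transcript P1 x else False # transcript P0 x)"

definition protocol_for :: "protocol \<Rightarrow> (nat \<times> nat \<Rightarrow> 'o) \<Rightarrow> (nat \<times> nat) set \<Rightarrow> bool" where
  "protocol_for P f X \<longleftrightarrow> (\<forall>x\<in>X. \<forall>y\<in>X. transcript P x = transcript P y \<longrightarrow> f x = f y)"

definition protocol_region :: "protocol \<Rightarrow> (nat \<times> nat) set \<Rightarrow> nat \<times> nat \<Rightarrow> (nat \<times> nat) set" where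
  "protocol_region P X x = {y \<in> X. transcript P y = transcript P x}"

definition ideal_region :: "(nat \<times> nat \<Rightarrow> 'o) \<Rightarrow> (nat \<times> nat) set \<Rightarrow> nat \<times> nat \<Rightarrow> (nat \<times> nat) set" where
  "ideal_region f X x = {y \<in> X. f y = f x}"

definition worst_case_objective_PAR ::
    "protocol \<Rightarrow> (nat \<times> nat \<Rightarrow> 'o) \<Rightarrow> (nat \<times> nat) set \<Rightarrow> real" where
  "worst_case_objective_PAR P f X =
     Max ((\<lambda>x. real (card (ideal_region f X x)) / real (card (protocol_region P X x))) ` X)"

definition inputs :: "nat \<Rightarrow> (nat \<times> nat) set" where
  "inputs k = {0..<2 ^ k} \<times> {0..<2 ^ k}"

fun second_price :: "nat \<times> nat \<Rightarrow> bidder \<times> nat" where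
  "second_price (x1, x2) = (if x1 \<ge> x2 then (Bidder1, x2) else (Bidder2, x1))"

text \<open>
  A rounding rule \<open>s\<close> for ratio \<open>c\<close>: an interval of size \<open>n \<ge> 2\<close> is split into a lower part of size
  \<open>s n\<close> and an upper part of size \<open>n - s n\<close>, both positive. Since \<open>0 < c < 1\<close>, the condition says
  exactly that \<open>s n\<close> is the floor or the ceiling of \<open>c * n\<close>, subject to both parts being nonempty;
  such a value always exists.
\<close>

definition rounding_rule :: "real \<Rightarrow> (nat \<Rightarrow> nat) \<Rightarrow> bool" where
  "rounding_rule c s \<longleftrightarrow>
     (\<forall>n\<ge>2. 0 < s n \<and> s n < n \<and> \<bar>real (s n) - c * real n\<bar> < 1)"

text \<open>
  The interval with least element \<open>lo\<close> and size \<open>n\<close> is \<open>{lo..<lo + n}\<close>. An announced bit is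
  \<open>True\<close> iff the announcing bidder's value is in the upper part. The conditions on \<open>s n\<close> in
  the two recursions below only serve termination for arbitrary \<open>s\<close>: for a rounding rule they hold
  whenever \<open>n \<ge> 2\<close>.
\<close>

function loser_search :: "(nat \<Rightarrow> nat) \<Rightarrow> bidder \<Rightarrow> nat \<Rightarrow> nat \<Rightarrow> protocol" where
  "loser_search s b lo n =
     (if n \<ge> 2 \<and> 0 < s n \<and> s n < n then
        Send b (\<lambda>x. lo + s n \<le> x)
          (loser_search s b lo (s n))
          (loser_search s b (lo + s n) (n - s n))
      else Halt)"
  by pat_completeness auto
termination by (relation "measure (\<lambda>(s, b, lo, n). n)") auto

function bisection :: "(nat \<Rightarrow> nat) \<Rightarrow> nat \<Rightarrow> nat \<Rightarrow> protocol" where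
  "bisection s lo n =
     (if n \<ge> 2 \<and> 0 < s n \<and> s n < n then
        Send Bidder1 (\<lambda>x. lo + s n \<le> x)
          (Send Bidder2 (\<lambda>x. lo + s n \<le> x)
            (bisection s lo (s n))
            (loser_search s Bidder1 lo (s n)))
          (Send Bidder2 (\<lambda>x. lo + s n \<le> x)
            (loser_search s Bidder2 lo (s n))
            (bisection s (lo + s n) (n - s n)))
      else Halt)"
  by pat_completeness auto
termination by (relation "measure (\<lambda>(s, lo, n). n)") auto

declare loser_search.simps [simp del] bisection.simps [simp del]

definition bisection_auction :: "(nat \<Rightarrow> nat) \<Rightarrow> nat \<Rightarrow> protocol" where
  "bisection_auction s k = bisection s 0 (2 ^ k)"

lemma rounding_rule_exists:
  assumes "0 < c" "c < 1"
  shows "\<exists>s. rounding_rule c s"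
proof -
  have "\<exists>m. 0 < m \<and> m < n \<and> \<bar>real m - c * real n\<bar> < 1" if n: "n \<ge> 2" for n :: nat
  proof (cases "c * real n < 1")
    case True
    with n assms show ?thesis by (intro exI[of _ 1]) auto
  next
    case False
    define m where "m = nat \<lfloor>c * real n\<rfloor>"
    have m: "real m = of_int \<lfloor>c * real n\<rfloor>" using False by (simp add: m_def)
    have "c * real n < real n" using n assms by simp
    with m have "m < n" by linarith
    moreover have "0 < m" using False m by linarith
    moreover have "\<bar>real m - c * real n\<bar> < 1" using m by linarith
    ultimately show ?thesis by blast
  qed
  then show ?thesis unfolding rounding_rule_def by metis
qed

lemma loser_search_finds:
  assumes "rounding_rule c s"
    and "own_input b x \<in> {lo..<lo + n}" "own_input b y \<in> {lo..<lo + n}"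
    and "transcript (loser_search s b lo n) x = transcript (loser_search s b lo n) y"
  shows "own_input b x = own_input b y"
  using assms
proof (induction s b lo n rule: loser_search.induct)
  case (1 s b lo n)
  show ?case
  proof (cases "n \<ge> 2")
    case False
    with "1.prems" show ?thesis by auto
  next
    case True
    then have s: "0 < s n" "s n < n"
      using "1.prems"(1) by (auto simp: rounding_rule_def)
    with True have ok: "n \<ge> 2 \<and> 0 < s n \<and> s n < n" by simp
    show ?thesis
      using "1.IH"(1)[OF ok "1.prems"(1)] "1.IH"(2)[OF ok "1.prems"(1)] "1.prems"(2-) ok
      by (subst (asm) (3 4) loser_search.simps) (auto split: if_splits)
  qed
qed

lemma bisection_correct:
  assumes "rounding_rule c s"
    and "fst x \<in> {lo..<lo + n}" "snd x \<in> {lo..<lo + n}"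
    and "fst y \<in> {lo..<lo + n}" "snd y \<in> {lo..<lo + n}"
    and "transcript (bisection s lo n) x = transcript (bisection s lo n) y"
  shows "second_price x = second_price y"
  using assms
proof (induction s lo n rule: bisection.induct)
  case (1 s lo n)
  obtain x1 x2 y1 y2 where xy [simp]: "x = (x1, x2)" "y = (y1, y2)"
    by (metis surj_pair)
  show ?case
  proof (cases "n \<ge> 2")
    case False
    with "1.prems" show ?thesis by auto
  next
    case True
    then have ok: "n \<ge> 2 \<and> 0 < s n \<and> s n < n"
      using "1.prems"(1) by (auto simp: rounding_rule_def)
    note L1 = loser_search_finds[OF "1.prems"(1), of Bidder1 x lo "s n" y, simplified]
    note L2 = loser_search_finds[OF "1.prems"(1), of Bidder2 x lo "s n" y, simplified]
    note I1 = "1.IH"(1)[OF ok "1.prems"(1), simplified]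
    note I2 = "1.IH"(2)[OF ok "1.prems"(1), simplified]
    have T: "transcript (bisection s lo n) (x1, x2) = transcript (bisection s lo n) (y1, y2)"
      using "1.prems"(6) by simp
    have unf: "bisection s lo n = Send Bidder1 (\<lambda>x. lo + s n \<le> x)
          (Send Bidder2 (\<lambda>x. lo + s n \<le> x) (bisection s lo (s n)) (loser_search s Bidder1 lo (s n)))
          (Send Bidder2 (\<lambda>x. lo + s n \<le> x) (loser_search s Bidder2 lo (s n))
            (bisection s (lo + s n) (n - s n)))"
      using ok by (subst bisection.simps) simp
    show ?thesis
      using T[unfolded unf] I1 I2 L1 L2 "1.prems"(2-5) ok
      by (simp split: if_splits)
  qed
qed

theorem bisection_auction_protocol_for:
  assumes "rounding_rule c s"
  shows "protocol_for (bisection_auction s k) second_price (inputs k)"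
  unfolding protocol_for_def bisection_auction_def inputs_def
  by (intro ballI impI bisection_correct[OF assms, where lo = 0 and n = "2 ^ k"]) auto

end

(* The value of (0, 0) is searched down to a singleton interval by both bidders, so its transcript
   is shared by no other input, whereas its outcome "bidder 1 wins at price 0" is shared by the 2^k
   inputs (x, 0). Hence the ratio is in fact at least 2^k. *)
theory Submission
  imports Defs
begin

text \<open>Two bidders holding the same value \<open>z\<close> always answer alike, so the run on
  \<open>(z, z)\<close> never enters \<open>loser_search\<close>. Equal bits therefore keep
  \<open>y1\<close> and \<open>y2\<close> in the interval of \<open>z\<close> until it is a
  singleton.\<close>

lemma bisection_diagonal_transcript:
  assumes "rounding_rule c s"
    and "y1 \<in> {lo..<lo + n}" "y2 \<in> {lo..<lo + n}" "z \<in> {lo..<lo + n}"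
    and "transcript (bisection s lo n) (y1, y2) = transcript (bisection s lo n) (z, z)"
  shows "y1 = z \<and> y2 = z"
  using assms
proof (induction s lo n rule: bisection.induct)
  case (1 s lo n)
  show ?case
  proof (cases "n \<ge> 2")
    case False
    with "1.prems" show ?thesis by auto
  next
    case True
    then have ok: "n \<ge> 2 \<and> 0 < s n \<and> s n < n"
      using "1.prems"(1) by (auto simp: rounding_rule_def)
    have unf: "bisection s lo n = Send Bidder1 (\<lambda>x. lo + s n \<le> x)
          (Send Bidder2 (\<lambda>x. lo + s n \<le> x) (bisection s lo (s n)) (loser_search s Bidder1 lo (s n)))
          (Send Bidder2 (\<lambda>x. lo + s n \<le> x) (loser_search s Bidder2 lo (s n))
            (bisection s (lo + s n) (n - s n)))"
      using ok by (subst bisection.simps) simp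
    show ?thesis
      \<comment> \<open>The first two bits put \<open>y1\<close> and \<open>y2\<close> on the same
        side of \<open>lo + s n\<close> as \<open>z\<close>; the induction hypothesis for that part
        then applies.\<close>
      using "1.prems"(5)[unfolded unf] "1.IH"[OF ok "1.prems"(1)] "1.prems"(2-4) ok
      by (simp split: if_splits)
  qed
qed

lemma protocol_region_bisection_auction_diagonal:
  assumes "rounding_rule c s" and "z < 2 ^ k"
  shows "protocol_region (bisection_auction s k) (inputs k) (z, z) = {(z, z)}"
  using assms bisection_diagonal_transcript[OF assms(1), where lo = 0 and n = "2 ^ k" and z = z]
  by (auto simp: protocol_region_def inputs_def bisection_auction_def)

lemma ideal_region_second_price_zero:
  "ideal_region second_price (inputs k) (0, 0) = {0..<2 ^ k} \<times> {0}"
  by (auto simp: ideal_region_def inputs_def split: if_splits)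

lemma worst_case_objective_PAR_bisection_auction_ge:
  assumes "rounding_rule c s"
  shows "worst_case_objective_PAR (bisection_auction s k) second_price (inputs k) \<ge> 2 ^ k"
proof -
  let ?ratio = "\<lambda>x. real (card (ideal_region second_price (inputs k) x)) /
    real (card (protocol_region (bisection_auction s k) (inputs k) x))"
  \<comment> \<open>The ideal region of \<open>(z, z)\<close> is
    \<open>{z..<2 ^ k} \<times> {z}\<close>, of size \<open>2 ^ k - z\<close>, so
    \<open>z = 0\<close> gives the largest ratio on the diagonal.\<close>
  have "?ratio (0, 0) \<le> Max (?ratio ` inputs k)"
    by (intro Max_ge imageI) (auto simp: inputs_def)
  then show ?thesis
    using protocol_region_bisection_auction_diagonal[OF assms, of 0 k]
    by (simp add: worst_case_objective_PAR_def ideal_region_second_price_zero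
        card_cartesian_product)
qed

theorem theorem5p1:
  fixes k :: nat and c :: real and s :: "nat \<Rightarrow> nat"
  assumes "k \<ge> 1"
    and "0 < c" and "c < 1"
    and "c > 1 / 2 ^ k"
    and "rounding_rule c s"
  shows "worst_case_objective_PAR (bisection_auction s k) second_price (inputs k)
           \<ge> 2 powr (real k / 2)"
proof -
  \<comment> \<open>The bound \<open>2 ^ k\<close> is weakened to the stated one by
    \<open>k / 2 \<le> k\<close>.\<close>
  have "(2::real) powr (real k / 2) \<le> 2 powr real k"
    by (intro powr_mono) auto
  also have "\<dots> = 2 ^ k"
    by (simp add: powr_realpow)
  also have "\<dots> \<le> worst_case_objective_PAR (bisection_auction s k) second_price (inputs k)"
    using worst_case_objective_PAR_bisection_auction_ge[OF assms(5)] .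
  finally show ?thesis .
qed

end
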